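(* For non-negative integers $n$ and $\ell$, and real numbers $m$ and $r$, the $r$-Dowling polynomials satisfy $$D_{m,r}(n+\ell;x)=\sum_{j=0}^{\ell}\sum_{k=0}^nW_{m,r}(\ell,j)\binom{n}{k}(mj)^{n-k}D_{m,r}(k;x)\,x^j .$$ Consequently, the $r$-Dowling numbers satisfy $$D_{m,r}(n+\ell)=\sum_{j=0}^{\ell}\sum_{k=0}^nW_{m,r}(\ell,j)\binom{n}{k}(mj)^{n-k}D_{m,r}(k).$$
   Context: The $r$-Whitney numbers of the second kind $W_{m,r}(n,k)$ (for integers $n,k\ge 0$) are the coefficients in $(mt+r)^n=\sum_{k=0}^n m^kW_{m,r}(n,k)(t)_k$, where $(t)_k=t(t-1)\cdots(t-k+1)$; equivalently $W_{m,r}(0,0)=1$, $W_{m,r}(n,k)=0$ if $k<0$ or $k>n$, and $W_{m,r}(n,k)=W_{m,r}(n-1,k-1)+(mk+r)W_{m,r}(n-1,k)$ for $n\ge1$. The $r$-Dowling polynomials are $D_{m,r}(n;x)=\sum_{k=0}^nW_{m,r}(n,k)x^k$ and the $r$-Dowling numbers are $D_{m,r}(n)=D_{m,r}(n;1)$. The convention $0^0=1$ is used. *)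

theory Defs
  imports Complex_Main "HOL-Computational_Algebra.Polynomial"
begin

text \<open>The recurrence, rather than the expansion of \<open>(m t + r)^n\<close> in falling factorials, serves as
  the definition: it determines the numbers for every real \<open>m\<close>, including \<open>m = 0\<close>, where the
  expansion does not.  Since \<open>k\<close> is a natural number, the term with index \<open>k - 1\<close> is simply absent
  for \<open>k = 0\<close>.\<close>

fun r_whitney2 :: "real \<Rightarrow> real \<Rightarrow> nat \<Rightarrow> nat \<Rightarrow> real" where
  "r_whitney2 m r 0 0 = 1"
| "r_whitney2 m r 0 (Suc k) = 0"
| "r_whitney2 m r (Suc n) 0 = r * r_whitney2 m r n 0"
| "r_whitney2 m r (Suc n) (Suc k) =
     r_whitney2 m r n k + (m * real (Suc k) + r) * r_whitney2 m r n (Suc k)"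

lemma r_whitney2_eq_0: "k > n \<Longrightarrow> r_whitney2 m r n k = 0"
  by (induction m r n k rule: r_whitney2.induct) auto

lemma r_whitney2_expansion:
  fixes m r t :: real
  shows "(m * t + r) ^ n = (\<Sum>k\<le>n. m ^ k * r_whitney2 m r n k * (\<Prod>i<k. t - real i))"
proof (induction n)
  case 0
  show ?case by simp
next
  case (Suc n)
  define F where "F k = (\<Prod>i<k. t - real i)" for k :: nat
  define W where "W = r_whitney2 m r"
  have F: "F (Suc k) = F k * (t - real k)" for k
    by (simp add: F_def)
  have "(m * t + r) ^ Suc n = (\<Sum>k\<le>n. (m * t + r) * (m ^ k * W n k * F k))"
    using Suc by (simp add: F_def W_def sum_distrib_left)
  also have "\<dots> = (\<Sum>k\<le>n. m ^ Suc k * W n k * F (Suc k))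
      + (\<Sum>k\<le>n. (m * real k + r) * (m ^ k * W n k * F k))"
    unfolding sum.distrib[symmetric] by (rule sum.cong) (simp_all add: F algebra_simps)
  also have "(\<Sum>k\<le>n. (m * real k + r) * (m ^ k * W n k * F k))
      = (\<Sum>k\<le>Suc n. (m * real k + r) * (m ^ k * W n k * F k))"
    by (simp add: W_def r_whitney2_eq_0)
  also have "\<dots> = r * (W n 0 * F 0)
      + (\<Sum>k\<le>n. (m * real (Suc k) + r) * (m ^ Suc k * W n (Suc k) * F (Suc k)))"
    by (subst sum.atMost_Suc_shift) simp
  also have "(\<Sum>k\<le>n. m ^ Suc k * W n k * F (Suc k)) + \<dots>
      = W (Suc n) 0 * F 0 + (\<Sum>k\<le>n. m ^ Suc k * W (Suc n) (Suc k) * F (Suc k))"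
    unfolding W_def r_whitney2.simps
    by (simp add: sum.distrib[symmetric] algebra_simps)
  also have "\<dots> = (\<Sum>k\<le>Suc n. m ^ k * W (Suc n) k * F k)"
    by (subst sum.atMost_Suc_shift) simp
  finally show ?case by (simp only: F_def W_def)
qed

definition r_dowling_poly :: "real \<Rightarrow> real \<Rightarrow> nat \<Rightarrow> real poly" where
  "r_dowling_poly m r n = (\<Sum>k\<le>n. monom (r_whitney2 m r n k) k)"

definition r_dowling :: "real \<Rightarrow> real \<Rightarrow> nat \<Rightarrow> real" where
  "r_dowling m r n = poly (r_dowling_poly m r n) 1"

end

theory Submission imports Defs begin

text \<open>The operator \<open>L p = (r + x) p + m x p'\<close> maps \<open>D(n; x)\<close> to \<open>D(n + 1; x)\<close>, and it satisfies
  \<open>L (x\<^sup>j p) = x\<^sup>j (L + m j) p\<close>.  Hence \<open>D(n + l; x) = L\<^sup>n D(l; x)\<close> is the sum of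
  \<open>W(l, j) x\<^sup>j (L + m j)\<^sup>n 1\<close> over \<open>j\<close>, where \<open>(L + m j)\<^sup>n\<close> is expanded by the binomial theorem.\<close>

lemma smult_sum_right: "smult c (\<Sum>i\<in>A. f i) = (\<Sum>i\<in>A. smult c (f i))"
  by (induction A rule: infinite_finite_induct) (simp_all add: smult_add_right)

definition dowling_op :: "real \<Rightarrow> real \<Rightarrow> real poly \<Rightarrow> real poly" where
  "dowling_op m r p = [:r, 1:] * p + [:0, m:] * pderiv p"

lemma dowling_op_add: "dowling_op m r (p + q) = dowling_op m r p + dowling_op m r q"
  by (simp add: dowling_op_def pderiv_add distrib_left del: mult_pCons_left)

lemma dowling_op_smult: "dowling_op m r (smult c p) = smult c (dowling_op m r p)"
  by (simp add: dowling_op_def pderiv_smult smult_add_right mult.commute)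

lemma dowling_op_funpow_add:
  "(dowling_op m r ^^ n) (p + q) = (dowling_op m r ^^ n) p + (dowling_op m r ^^ n) q"
  by (induction n) (simp_all add: dowling_op_add)

lemma dowling_op_funpow_smult:
  "(dowling_op m r ^^ n) (smult c p) = smult c ((dowling_op m r ^^ n) p)"
  by (induction n) (simp_all add: dowling_op_smult)

lemma dowling_op_funpow_sum:
  "(dowling_op m r ^^ n) (\<Sum>i\<in>A. f i) = (\<Sum>i\<in>A. (dowling_op m r ^^ n) (f i))"
proof (induction A rule: infinite_finite_induct)
  case (insert i A)
  then show ?case by (simp add: dowling_op_funpow_add)
\<comment> \<open>The empty and infinite cases need L^n 0 = 0, which is homogeneity with scalar
  0.\<close>
qed (use dowling_op_funpow_smult[of n m r 0 0] in simp_all)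

lemma dowling_op_mult_monom:
  "dowling_op m r (p * monom 1 j) = (dowling_op m r p + smult (m * real j) p) * monom 1 j"
proof -
  \<comment> \<open>The factor x restores the exponent lowered by differentiation; for
    \<open>j = 0\<close> the truncated \<open>j - 1\<close> is harmless, as the coefficient is
    0.\<close>
  have "[:0, m:] * monom (real j) (j - 1) = smult (m * real j) (monom 1 j)"
    by (cases j) (simp_all add: monom_Suc smult_monom)
  then have "[:0, m:] * (monom (real j) (j - 1) * p) = smult (m * real j) (monom 1 j) * p"
    by (metis mult.assoc)
  then show ?thesis
    by (simp add: dowling_op_def pderiv_mult pderiv_monom algebra_simps)
qed

lemma coeff_r_dowling_poly: "coeff (r_dowling_poly m r n) k = r_whitney2 m r n k"
  by (simp add: r_dowling_poly_def coeff_sum r_whitney2_eq_0)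

text \<open>At x^k, the factor r + x contributes r W(n,k) + W(n,k-1) and m x p' contributes m k
  W(n,k), which together are the Whitney recurrence.\<close>

lemma r_dowling_poly_Suc: "r_dowling_poly m r (Suc n) = dowling_op m r (r_dowling_poly m r n)"
proof (rule poly_eqI)
  fix k
  show "coeff (r_dowling_poly m r (Suc n)) k = coeff (dowling_op m r (r_dowling_poly m r n)) k"
    by (cases k) (simp_all add: coeff_r_dowling_poly dowling_op_def coeff_pderiv algebra_simps)
qed

lemma r_dowling_poly_add:
  "r_dowling_poly m r (n + l) = (dowling_op m r ^^ n) (r_dowling_poly m r l)"
  by (induction n) (simp_all add: r_dowling_poly_Suc)

lemma r_dowling_poly_eq_funpow: "r_dowling_poly m r n = (dowling_op m r ^^ n) 1"
  using r_dowling_poly_add[of m r n 0] by (simp add: r_dowling_poly_def)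

text \<open>Pascal's rule, shaped for expanding (L + c)^(n+1): the index shift in \<open>a\<close>
  stands for one more L.\<close>

lemma binomial_sum_Suc:
  fixes c :: "'a :: comm_ring_1" and a :: "nat \<Rightarrow> 'a poly"
  shows "(\<Sum>k\<le>Suc n. smult (of_nat (Suc n choose k) * c ^ (Suc n - k)) (a k)) =
    (\<Sum>k\<le>n. smult (of_nat (n choose k) * c ^ (n - k)) (a (Suc k))) +
    smult c (\<Sum>k\<le>n. smult (of_nat (n choose k) * c ^ (n - k)) (a k))"
proof -
  have "smult c (\<Sum>k\<le>n. smult (of_nat (n choose k) * c ^ (n - k)) (a k)) =
    (\<Sum>k\<le>n. smult (of_nat (n choose k) * c ^ (Suc n - k)) (a k))"
    by (simp add: smult_sum_right Suc_diff_le mult.left_commute)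
  \<comment> \<open>The added term vanishes since \<open>n choose Suc n\<close> is 0; the term at 0
    can now be split off on both sides.\<close>
  also have "\<dots> = (\<Sum>k\<le>Suc n. smult (of_nat (n choose k) * c ^ (Suc n - k)) (a k))"
    by (simp add: binomial_eq_0)
  also have "\<dots> = smult (c ^ Suc n) (a 0) +
    (\<Sum>k\<le>n. smult (of_nat (n choose Suc k) * c ^ (n - k)) (a (Suc k)))"
    by (subst sum.atMost_Suc_shift) simp
  finally show ?thesis
    by (subst sum.atMost_Suc_shift)
      (simp add: sum.distrib smult_add_left distrib_right)
qed

lemma dowling_op_funpow_mult_monom:
  "(dowling_op m r ^^ n) (p * monom 1 j) =
    (\<Sum>k\<le>n. smult (real (n choose k) * (m * real j) ^ (n - k))
      ((dowling_op m r ^^ k) p * monom 1 j))"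
proof (induction n arbitrary: p)
  case 0
  show ?case by simp
next
  case (Suc n)
  have "(dowling_op m r ^^ Suc n) (p * monom 1 j) =
      (dowling_op m r ^^ n) (dowling_op m r p * monom 1 j) +
      smult (m * real j) ((dowling_op m r ^^ n) (p * monom 1 j))"
    by (simp add: funpow_Suc_right dowling_op_mult_monom distrib_right dowling_op_funpow_add
        dowling_op_funpow_smult del: funpow.simps)
  then show ?case
    \<comment> \<open>The induction hypothesis is used at both L p and p, with L^k (L p) = L (L^k
      p).\<close>
    unfolding binomial_sum_Suc Suc.IH by (simp add: funpow_swap1)
qed

theorem theorem2:
  fixes n l :: nat and m r :: real
  shows "r_dowling_poly m r (n + l) =
           (\<Sum>j\<le>l. \<Sum>k\<le>n.
              smult (r_whitney2 m r l j * real (n choose k) * (m * real j) ^ (n - k))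
                (r_dowling_poly m r k * monom 1 j))
       \<and> r_dowling m r (n + l) =
           (\<Sum>j\<le>l. \<Sum>k\<le>n.
              r_whitney2 m r l j * real (n choose k) * (m * real j) ^ (n - k) * r_dowling m r k)"
proof -
  \<comment> \<open>The explicit factor 1 lets \<open>dowling_op_funpow_mult_monom\<close> apply
    with \<open>p = 1\<close>, so \<open>mult_1_left\<close> is disabled below.\<close>
  have "r_dowling_poly m r l = (\<Sum>j\<le>l. smult (r_whitney2 m r l j) (1 * monom 1 j))"
    by (simp add: r_dowling_poly_def smult_monom)
  then have *: "r_dowling_poly m r (n + l) =
           (\<Sum>j\<le>l. \<Sum>k\<le>n.
              smult (r_whitney2 m r l j * real (n choose k) * (m * real j) ^ (n - k))
                (r_dowling_poly m r k * monom 1 j))"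
    unfolding r_dowling_poly_add[of m r n l]
    by (simp add: dowling_op_funpow_sum dowling_op_funpow_smult dowling_op_funpow_mult_monom
        smult_sum_right mult.assoc r_dowling_poly_eq_funpow[symmetric]
        del: mult_1_left)
  show ?thesis
    \<comment> \<open>Evaluation at x = 1 removes the powers of x.\<close>
    using * by (simp add: r_dowling_def poly_sum poly_monom)
qed

end
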